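(* Let $\mathcal{B}$ be a boolean $\mathcal{C}$-algebra. Then $\mathcal{B}$ is equationally Noetherian if and only if the subalgebra $\mathcal{C}$ generated by the constants of the language $\mathcal{L}$ is finite.
   Context: Language. Let $\mathcal{L}=\{\vee,\cdot,\bar{\ },0,1\}\cup\{\mathbf{c}_i\mid i\in I\}$ be the language of boolean algebras (disjunction, conjunction, negation, $0$, $1$) extended by an arbitrary (possibly infinite) set of constant symbols. A boolean $\mathcal{C}$-algebra is a boolean algebra $\mathcal{B}$ regarded as a structure of the language $\mathcal{L}$, where $\mathcal{C}\subseteq\mathcal{B}$ denotes the boolean subalgebra generated by (the interpretations of) the constants $\mathbf{c}_i$, $i\in I$. Equations. For a finite set of variables $X=\{x_1,\dots,x_n\}$, an equation over $\mathcal{B}$ is an atomic formula $\tau(X)=\sigma(X)$, where $\tau,\sigma$ are $\mathcal{L}$-terms in $X$. A system is an arbitrary (possibly infinite) set of equations in a common finite set of variables. Two systems in variables $X$ are equivalent over $\mathcal{B}$ if they have the same solution set in $\mathcal{B}^n$. Equationally Noetherian. $\mathcal{B}$ is equationally Noetherian if for any system $\mathcal{S}$ (consistent or not) there exists a finite subsystem $\mathcal{S}'\subseteq\mathcal{S}$ equivalent to $\mathcal{S}$ over $\mathcal{B}$. *)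

theory Defs
  imports Complex_Main "HOL-Library.FuncSet"
begin

text \<open>
  The algebra is the carrier of a type of class \<^class>\<open>boolean_algebra\<close>, with \<open>\<squnion>\<close>, \<open>\<sqinter>\<close>, \<open>-\<close>, \<open>\<bottom>\<close>, \<open>\<top>\<close>
  for disjunction, conjunction, negation, 0 and 1; the one-element algebra is not excluded.
  The language is given by a set \<open>I\<close> of constant symbols (any cardinality, possibly empty, hence a
  set rather than a whole type) and their interpretation \<open>c\<close>, which matters only on \<open>I\<close>.
\<close>

unbundle lattice_syntax

datatype (term_consts: 'i, term_vars: 'v) bterm =
    Zero
  | One
  | Var 'v
  | Const 'i
  | Neg "('i, 'v) bterm"
  | Or "('i, 'v) bterm" "('i, 'v) bterm"
  | And "('i, 'v) bterm" "('i, 'v) bterm"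

primrec eval :: "('i \<Rightarrow> 'b::boolean_algebra) \<Rightarrow> ('v \<Rightarrow> 'b) \<Rightarrow> ('i, 'v) bterm \<Rightarrow> 'b" where
  "eval c p Zero = \<bottom>"
| "eval c p One = \<top>"
| "eval c p (Var x) = p x"
| "eval c p (Const i) = c i"
| "eval c p (Neg t) = - eval c p t"
| "eval c p (Or s t) = eval c p s \<squnion> eval c p t"
| "eval c p (And s t) = eval c p s \<sqinter> eval c p t"

text \<open>The variables \<open>x\<^sub>1, \<dots>, x\<^sub>n\<close> are the numbers \<open>0, \<dots>, n - 1\<close>, and an equation is a pair of terms.\<close>

definition lterms :: "'i set \<Rightarrow> nat \<Rightarrow> ('i, nat) bterm set" where
  "lterms I n = {t. term_consts t \<subseteq> I \<and> term_vars t \<subseteq> {..<n}}"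

type_synonym 'i equation = "('i, nat) bterm \<times> ('i, nat) bterm"

definition is_system :: "'i set \<Rightarrow> nat \<Rightarrow> 'i equation set \<Rightarrow> bool" where
  "is_system I n S \<longleftrightarrow> S \<subseteq> lterms I n \<times> lterms I n"

definition solutions :: "('i \<Rightarrow> 'b::boolean_algebra) \<Rightarrow> nat \<Rightarrow> 'i equation set \<Rightarrow> (nat \<Rightarrow> 'b) set" where
  "solutions c n S = {p \<in> {..<n} \<rightarrow>\<^sub>E UNIV. \<forall>(s, t) \<in> S. eval c p s = eval c p t}"

definition equivalent_systems ::
    "('i \<Rightarrow> 'b::boolean_algebra) \<Rightarrow> nat \<Rightarrow> 'i equation set \<Rightarrow> 'i equation set \<Rightarrow> bool" where
  "equivalent_systems c n S T \<longleftrightarrow> solutions c n S = solutions c n T"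

definition equationally_noetherian :: "'i set \<Rightarrow> ('i \<Rightarrow> 'b::boolean_algebra) \<Rightarrow> bool" where
  "equationally_noetherian I c \<longleftrightarrow>
    (\<forall>n S. is_system I n S \<longrightarrow> (\<exists>S' \<subseteq> S. finite S' \<and> equivalent_systems c n S' S))"

definition boolean_subalgebra :: "'b::boolean_algebra set \<Rightarrow> bool" where
  "boolean_subalgebra A \<longleftrightarrow> \<bottom> \<in> A \<and> \<top> \<in> A \<and> (\<forall>x\<in>A. - x \<in> A) \<and>
    (\<forall>x\<in>A. \<forall>y\<in>A. x \<squnion> y \<in> A \<and> x \<sqinter> y \<in> A)"

definition constant_subalgebra :: "'i set \<Rightarrow> ('i \<Rightarrow> 'b::boolean_algebra) \<Rightarrow> 'b set" where
  "constant_subalgebra I c = boolean_subalgebra hull (c ` I)"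

end

theory Submission
  imports Defs
begin

text \<open>
  A term function is determined by its values at the \<open>2\<^sup>n\<close> points with coordinates in \<open>{\<bottom>, \<top>}\<close>
  (Shannon expansion), and these values lie in the subalgebra generated by the constants. If that
  subalgebra is finite, there are only finitely many term functions, hence only finitely many
  equations up to equivalence.

  Conversely, an infinite Boolean algebra has an infinite strictly descending chain
  \<open>f 0 > f 1 > \<dots>\<close>: if there are infinitely many elements below \<open>x\<close>, then for \<open>\<bottom> < y < x\<close> there
  are infinitely many below \<open>y\<close> or below \<open>x \<sqinter> - y\<close>. The system \<open>{x \<le> f k | k}\<close> is not equivalent
  to any of its finite subsystems.
\<close>

lemma eval_cong:
  assumes "\<And>x. x \<in> term_vars t \<Longrightarrow> p x = q x"
  shows "eval c p t = eval c q t"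
  using assms by (induction t) auto

text \<open>Agreement after meeting with \<open>a\<close> is a congruence for all the operations:
  \<open>\<lambda>b. a \<sqinter> b\<close> is a homomorphism onto the algebra of elements below
  \<open>a\<close>, with relative complements there.\<close>

lemma inf_eval_update:
  fixes c :: "'i \<Rightarrow> 'b::boolean_algebra"
  assumes "a \<sqinter> p x = a \<sqinter> e"
  shows "a \<sqinter> eval c p t = a \<sqinter> eval c (p(x := e)) t"
proof (induction t)
  case (Neg t)
  have "a \<sqinter> - b = a \<sqinter> - (a \<sqinter> b)" for b
    by (simp add: inf_sup_distrib1)
  then show ?case
    using Neg by (metis eval.simps(5))
next
  case (And s t)
  have "a \<sqinter> (b \<sqinter> d) = (a \<sqinter> b) \<sqinter> (a \<sqinter> d)" for b d
    by (simp add: inf_left_commute inf_assoc)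
  then show ?case
    using And by (metis eval.simps(7))
qed (use assms in \<open>simp_all add: inf_sup_distrib1\<close>)

text \<open>Below \<open>p x\<close> the value \<open>p x\<close> agrees with \<open>\<top>\<close>,
  and below \<open>- p x\<close> it agrees with \<open>\<bottom>\<close>; the two parts join to the
  whole.\<close>

lemma eval_shannon:
  "eval c p t = (p x \<sqinter> eval c (p(x := \<top>)) t) \<squnion> (- p x \<sqinter> eval c (p(x := \<bottom>)) t)"
proof -
  have "eval c p t = (p x \<sqinter> eval c p t) \<squnion> (- p x \<sqinter> eval c p t)"
    by (simp flip: inf_sup_distrib2)
  moreover have "p x \<sqinter> eval c p t = p x \<sqinter> eval c (p(x := \<top>)) t"
    "- p x \<sqinter> eval c p t = - p x \<sqinter> eval c (p(x := \<bottom>)) t"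
    by (rule inf_eval_update; simp)+
  ultimately show ?thesis by simp
qed

text \<open>Shannon expansion replaces one coordinate at a time by \<open>\<top>\<close> and
  \<open>\<bottom>\<close>. Coordinates outside \<open>V\<close> keep their values from
  \<open>p\<close>, which is generalized in the induction.\<close>

lemma eval_eqI_two_valued:
  assumes "finite V"
    and "\<And>q. \<lbrakk>\<And>x. x \<in> V \<Longrightarrow> q x \<in> {\<bottom>, \<top>}; \<And>x. x \<notin> V \<Longrightarrow> q x = p x\<rbrakk>
      \<Longrightarrow> eval c q s = eval c q t"
  shows "eval c p s = eval c p t"
  using assms
proof (induction V arbitrary: p rule: finite_induct)
  case empty
  then show ?case by simp
next
  case (insert x V)
  have "eval c (p(x := e)) s = eval c (p(x := e)) t" if "e \<in> {\<bottom>, \<top>}" for e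
  proof (rule insert.IH)
    fix q
    assume *: "\<And>y. y \<in> V \<Longrightarrow> q y \<in> {\<bottom>, \<top>}" "\<And>y. y \<notin> V \<Longrightarrow> q y = (p(x := e)) y"
    show "eval c q s = eval c q t"
    proof (rule insert.prems)
      show "q y \<in> {\<bottom>, \<top>}" if "y \<in> insert x V" for y
        using that * \<open>e \<in> {\<bottom>, \<top>}\<close> insert.hyps by (cases "y = x") auto
      show "q y = p y" if "y \<notin> insert x V" for y
        using that *(2) by simp
    qed
  qed
  then show ?case
    by (subst (1 2) eval_shannon[where x = x]) simp
qed

lemma eval_in_subalgebra:
  assumes "boolean_subalgebra A" "c ` term_consts t \<subseteq> A" "p ` term_vars t \<subseteq> A"
  shows "eval c p t \<in> A"
  using assms(2,3) assms(1) by (induction t) (auto simp: boolean_subalgebra_def image_Un)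

lemma boolean_subalgebra_constant_subalgebra: "boolean_subalgebra (constant_subalgebra I c)"
  unfolding constant_subalgebra_def
  by (rule hull_in) (auto simp: boolean_subalgebra_def)

lemma constants_subset_constant_subalgebra: "c ` I \<subseteq> constant_subalgebra I c"
  unfolding constant_subalgebra_def by (rule hull_subset)

text \<open>Term values contain the constants and are closed under the operations. With
  \<open>n = 0\<close> this names every element of the subalgebra by a closed term.\<close>

lemma constant_subalgebra_subset_eval: "constant_subalgebra I c \<subseteq> eval c p ` lterms I n"
  unfolding constant_subalgebra_def
proof (rule hull_minimal)
  show "c ` I \<subseteq> eval c p ` lterms I n"
  proof
    fix b assume "b \<in> c ` I"
    then obtain i where "Const i \<in> lterms I n" "b = eval c p (Const i)"
      by (auto simp: lterms_def)
    then show "b \<in> eval c p ` lterms I n" by blast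
  qed
  have "eval c p Zero \<in> eval c p ` lterms I n" "eval c p One \<in> eval c p ` lterms I n"
    by (intro imageI; simp add: lterms_def)+
  moreover have "eval c p (Neg s) \<in> eval c p ` lterms I n"
    "eval c p (Or s t) \<in> eval c p ` lterms I n" "eval c p (And s t) \<in> eval c p ` lterms I n"
    if "s \<in> lterms I n" "t \<in> lterms I n" for s t
    using that by (intro imageI; simp add: lterms_def)+
  ultimately show "boolean_subalgebra (eval c p ` lterms I n)"
    unfolding boolean_subalgebra_def by simp
qed

lemma equationally_noetherian_if_finite:
  fixes c :: "'i \<Rightarrow> 'b::boolean_algebra"
  assumes "finite (constant_subalgebra I c)"
  shows "equationally_noetherian I c"
  unfolding equationally_noetherian_def
proof (intro allI impI)
  fix n and S :: "'i equation set"
  assume "is_system I n S"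
  then have S: "s \<in> lterms I n" "t \<in> lterms I n" if "(s, t) \<in> S" for s t
    using that by (auto simp: is_system_def)
  define C where "C = constant_subalgebra I c"
  \<comment> \<open>\<open>pt A\<close> is the two-valued point with indicator set \<open>A\<close>,
    and \<open>F t\<close> is the truth table of \<open>t\<close>. Restricting tables to
    \<open>Pow {..<n}\<close> puts them into a finite function space.\<close>
  define pt :: "nat set \<Rightarrow> nat \<Rightarrow> 'b" where "pt A = (\<lambda>i. if i \<in> A then \<top> else \<bottom>)" for A
  define F where "F t = (\<lambda>A\<in>Pow {..<n}. eval c (pt A) t)" for t
  have F_in: "F t \<in> Pow {..<n} \<rightarrow>\<^sub>E C" if "t \<in> lterms I n" for t
  proof -
    have "eval c (pt A) t \<in> C" for A
    proof (rule eval_in_subalgebra)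
      show sub: "boolean_subalgebra C"
        unfolding C_def by (rule boolean_subalgebra_constant_subalgebra)
      show "c ` term_consts t \<subseteq> C"
        using that constants_subset_constant_subalgebra[of c I] by (auto simp: C_def lterms_def)
      show "pt A ` term_vars t \<subseteq> C"
        using sub by (auto simp: pt_def boolean_subalgebra_def)
    qed
    then show ?thesis by (auto simp: F_def)
  qed
  have F_inj: "eval c p s = eval c p t"
    if "F s = F t" and st: "s \<in> lterms I n" "t \<in> lterms I n" for p s t
  proof (rule eval_eqI_two_valued[of "{..<n}"])
    fix q :: "nat \<Rightarrow> 'b"
    assume q: "\<And>x. x \<in> {..<n} \<Longrightarrow> q x \<in> {\<bottom>, \<top>}"
    define A where "A = {i \<in> {..<n}. q i = \<top>}"
    have "eval c q u = F u A" if "u \<in> lterms I n" for u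
    proof -
      have "eval c q u = eval c (pt A) u"
        by (rule eval_cong) (use that q in \<open>auto simp: lterms_def A_def pt_def\<close>)
      then show ?thesis by (auto simp: F_def A_def)
    qed
    with that show "eval c q s = eval c q t" by simp
  qed simp
  have "map_prod F F ` S \<subseteq> (Pow {..<n} \<rightarrow>\<^sub>E C) \<times> (Pow {..<n} \<rightarrow>\<^sub>E C)"
    using S by (auto intro!: F_in)
  moreover have "finite (Pow {..<n} \<rightarrow>\<^sub>E C)"
    using assms by (intro finite_PiE) (auto simp: C_def)
  ultimately have "finite (map_prod F F ` S)"
    by (meson finite_SigmaI finite_subset)
  \<comment> \<open>\<open>S'\<close> keeps at least one equation of \<open>S\<close> for every pair
    of tables that occurs.\<close>
  then obtain S' where S': "S' \<subseteq> S" "finite S'"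
      "map_prod F F ` S = map_prod F F ` S'"
    by (meson finite_subset_image subset_refl)
  have "eval c p s = eval c p t"
    if p: "\<forall>(s, t)\<in>S'. eval c p s = eval c p t" and st: "(s, t) \<in> S" for p s t
  proof -
    obtain s' t' where *: "(s', t') \<in> S'" "F s = F s'" "F t = F t'"
    proof -
      have "(F s, F t) \<in> map_prod F F ` S'"
        using st S'(3) by force
      then show ?thesis using that by auto
    qed
    then have "eval c p s = eval c p s'" "eval c p t = eval c p t'"
      using S'(1) S st by (meson F_inj subsetD)+
    then show ?thesis using p * by auto
  qed
  then have "(\<forall>(s, t)\<in>S'. eval c p s = eval c p t) \<longleftrightarrow> (\<forall>(s, t)\<in>S. eval c p s = eval c p t)" for p
    using S'(1) by blast
  then have "equivalent_systems c n S' S"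
    by (simp add: equivalent_systems_def solutions_def)
  then show "\<exists>S'\<subseteq>S. finite S' \<and> equivalent_systems c n S' S"
    using S' by blast
qed

lemma infinite_below_smaller:
  fixes C :: "'b::boolean_algebra set"
  assumes C: "boolean_subalgebra C" and x: "x \<in> C" "infinite {z \<in> C. z \<le> x}"
  shows "\<exists>y\<in>C. y < x \<and> infinite {z \<in> C. z \<le> y}"
proof -
  have "\<not> {z \<in> C. z \<le> x} \<subseteq> {\<bottom>, x}"
    using x(2) by (meson finite.emptyI finite.insertI finite_subset)
  then obtain y where y: "y \<in> C" "y \<le> x" "y \<noteq> \<bottom>" "y \<noteq> x" by blast
  let ?y' = "x \<sqinter> - y"
  have y': "?y' \<in> C" "?y' \<le> x"
    using C x y by (auto simp: boolean_subalgebra_def)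
  have "?y' \<noteq> x"
  proof
    assume "?y' = x"
    then have "y \<le> - y" using y(2) by (metis inf.cobounded2 order_trans)
    then show False using y(3) by (metis inf.absorb1 inf_compl_bot)
  qed
  have "infinite {z \<in> C. z \<le> y} \<or> infinite {z \<in> C. z \<le> ?y'}"
  proof (rule ccontr)
    assume "\<not> ?thesis"
    then have fin: "finite ((\<lambda>(a, b). a \<squnion> b) ` ({z \<in> C. z \<le> y} \<times> {z \<in> C. z \<le> ?y'}))"
      by simp
    \<comment> \<open>Every element below \<open>x\<close> is the join of its parts below
      \<open>y\<close> and below \<open>x \<sqinter> - y\<close>, so finitely many of each would
      leave only finitely many below \<open>x\<close>.\<close>
    have "{z \<in> C. z \<le> x} \<subseteq> (\<lambda>(a, b). a \<squnion> b) ` ({z \<in> C. z \<le> y} \<times> {z \<in> C. z \<le> ?y'})"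
    proof
      fix z assume z: "z \<in> {z \<in> C. z \<le> x}"
      have "z = (z \<sqinter> y) \<squnion> (z \<sqinter> - y)"
        by (simp flip: inf_sup_distrib1)
      moreover have "z \<sqinter> y \<in> C" "z \<sqinter> - y \<in> C" "z \<sqinter> - y \<le> ?y'"
        using z C y by (auto simp: boolean_subalgebra_def intro: le_infI1)
      ultimately show "z \<in> (\<lambda>(a, b). a \<squnion> b) ` ({z \<in> C. z \<le> y} \<times> {z \<in> C. z \<le> ?y'})"
        by (intro image_eqI[of _ _ "(z \<sqinter> y, z \<sqinter> - y)"]) auto
    qed
    then show False using fin x(2) finite_subset by blast
  qed
  then show ?thesis
    using y y' \<open>?y' \<noteq> x\<close> by (metis order.not_eq_order_implies_strict)
qed

lemma infinite_descending_chain: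
  fixes C :: "'b::boolean_algebra set"
  assumes C: "boolean_subalgebra C" "infinite C"
  obtains f :: "nat \<Rightarrow> 'b" where "range f \<subseteq> C" "\<And>k. f (Suc k) < f k"
proof -
  \<comment> \<open>Having infinitely many elements of \<open>C\<close> below \<open>f k\<close> is
    the invariant that lets the choice continue; it starts at \<open>\<top>\<close>.\<close>
  have "\<exists>f. \<forall>k. (f k \<in> C \<and> infinite {z \<in> C. z \<le> f k}) \<and> f (Suc k) < f k"
  proof (rule dependent_nat_choice)
    show "\<exists>x. x \<in> C \<and> infinite {z \<in> C. z \<le> x}"
      using C by (intro exI[of _ \<top>]) (simp add: boolean_subalgebra_def)
    show "\<exists>y. (y \<in> C \<and> infinite {z \<in> C. z \<le> y}) \<and> y < x"
      if "x \<in> C \<and> infinite {z \<in> C. z \<le> x}" for x and k :: nat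
      using infinite_below_smaller[OF C(1)] that by blast
  qed
  then show ?thesis using that by blast
qed

lemma finite_if_equationally_noetherian:
  fixes c :: "'i \<Rightarrow> 'b::boolean_algebra"
  assumes "equationally_noetherian I c"
  shows "finite (constant_subalgebra I c)"
proof (rule ccontr)
  assume "infinite (constant_subalgebra I c)"
  then obtain f :: "nat \<Rightarrow> 'b"
    where f: "range f \<subseteq> constant_subalgebra I c" and dec: "\<And>k. f (Suc k) < f k"
    using infinite_descending_chain boolean_subalgebra_constant_subalgebra by metis
  have "\<exists>t \<in> lterms I 0. f k = eval c (\<lambda>_. \<bottom>) t" for k
    using f constant_subalgebra_subset_eval[of I c "\<lambda>_. \<bottom>" 0] by blast
  then obtain t where t: "\<And>k. t k \<in> lterms I 0" and f_eq: "\<And>k. f k = eval c (\<lambda>_. \<bottom>) (t k)"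
    by metis
  \<comment> \<open>The terms \<open>t k\<close> are closed, so the point
    \<open>\<lambda>_. \<bottom>\<close> used to obtain them can be replaced by any other.\<close>
  have eval_t: "eval c p (t k) = f k" for p k
    unfolding f_eq by (rule eval_cong) (use t in \<open>auto simp: lterms_def\<close>)
  \<comment> \<open>The inequality \<open>x \<le> f k\<close> is written as the equation
    \<open>x \<sqinter> f k = x\<close>.\<close>
  define e where "e k = (And (Var 0) (t k), Var 0 :: ('i, nat) bterm)" for k
  have solutions_iff: "p \<in> solutions c 1 (e ` K) \<longleftrightarrow>
      p \<in> {..<1} \<rightarrow>\<^sub>E UNIV \<and> (\<forall>k\<in>K. p 0 \<le> f k)" for p K
    by (auto simp: solutions_def e_def eval_t le_iff_inf)
  have "is_system I 1 (range e)"
    using t unfolding is_system_def e_def lterms_def by fastforce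
  then obtain S' where S': "S' \<subseteq> range e" "finite S'" "solutions c 1 S' = solutions c 1 (range e)"
    using assms unfolding equationally_noetherian_def equivalent_systems_def by blast
  then obtain K where K: "finite K" "S' = e ` K"
    by (meson finite_subset_image)
  then obtain N where N: "\<And>k. k \<in> K \<Longrightarrow> k \<le> N"
    using finite_nat_set_iff_bounded_le by auto
  have "decseq f"
    using dec by (simp add: decseq_SucI less_imp_le)
  \<comment> \<open>The point \<open>x = f N\<close> satisfies every inequality with index at most
    \<open>N\<close>, hence \<open>S'\<close>, but violates the one with index
    \<open>Suc N\<close>.\<close>
  then have "(\<lambda>i\<in>{..<1}. f N) \<in> solutions c 1 S'"
    unfolding K(2) solutions_iff using N by (auto simp: decseq_def)
  then have "f N \<le> f (Suc N)"
    unfolding S'(3) solutions_iff by simp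
  with dec[of N] show False by simp
qed

theorem theorem4p1:
  fixes I :: "'i set" and c :: "'i \<Rightarrow> 'b::boolean_algebra"
  shows "equationally_noetherian I c \<longleftrightarrow> finite (constant_subalgebra I c)"
  using equationally_noetherian_if_finite finite_if_equationally_noetherian by blast

end
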